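(* Let $k_1(x,y)=x^\top y$ and let $k_2:\mathcal{R}\times\mathcal{R}\to\mathbb{C}$ be a kernel of the form $$k_2(x,y)=\sum_{k\in\mathbb{N}\setminus\{1\}}a_k\,(x^\top y)^k,\qquad a_k>0 \text{ for all } k\in\mathbb{N}\setminus\{1\},$$ for any $(x,y)\in\mathcal{R}\times\mathcal{R}$ (here $0\in\mathbb{N}$). Let $\mathcal{H}_1$ and $\mathcal{H}_2$ be the reproducing kernel Hilbert spaces on $\mathcal{R}$ with kernels $k_1$ and $k_2$ respectively, and suppose that $\mathcal{H}_1\oplus\mathcal{H}_2\subseteq\mathcal{F}=C^1(\mathcal{R})$. Let $Q=\{q_1,\dots,q_m\}\subset\mathcal{R}$ be a set of distinct points such that the Gram matrix $[\mathbf{G}]_{ij}=k_2(q_i,q_j)$ is invertible. Let $\mathcal{H}_{2,m}=\mathrm{span}\{k_2(\cdot,q_i)\}_{i=1}^m$, $S=\mathcal{H}_1\oplus\mathcal{H}_{2,m}$, and let $\Pi:\mathcal{F}\to S$ be given by $$(\Pi g)(x)=\nabla g(0)^\top x+\mathcal{I}_{Q,k_2}\big(g-\nabla g(0)^\top (\cdot)\big)(x).$$ Then the restriction $\Pi|_{\mathcal{H}_1\oplus\mathcal{H}_2}$ is an orthogonal projection in $\mathcal{H}_1\oplus\mathcal{H}_2$.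
   Context: Setting: $\mathbb{X}\subset\mathbb{R}^n$ is a compact set containing the origin, and $\dot x=F(x)$ is a dynamical system with $F$ Lipschitz and analytic in $\mathbb{X}$, with flow map $\varphi^t$, having a locally stable hyperbolic equilibrium at the origin. Its region of attraction is $\mathcal{R}=\{x\in\mathbb{X}: \lim_{t\to\infty}\varphi^t(x)=0\}$, which contains a ball centered at the origin. $\mathcal{F}=C^1(\mathcal{R})$ (complex-valued functions). A reproducing kernel Hilbert space (RKHS) on a set is a Hilbert space of complex-valued functions on it for which all point evaluations are bounded; its kernel $k$ satisfies $\langle f,k(x,\cdot)\rangle=f(x)$. The RKHS $\mathcal{H}_1$ with kernel $k_1(x,y)=x^\top y$ is the space of linear functions $\mathrm{span}\{x_1,\dots,x_n\}$. The space $\mathcal{H}_1\oplus\mathcal{H}_2$ carries the inner product of the RKHS with kernel $k_1+k_2$. Interpolation operator: for a function $g$ on $\mathcal{R}$, $\mathcal{I}_{Q,k_2}(g)=\sum_{j=1}^m\alpha_j k_2(\cdot,q_j)$, where $\alpha=(\alpha_1,\dots,\alpha_m)^\top$ solves $\mathbf{G}\alpha=(g(q_1),\dots,g(q_m))^\top$; thus $\mathcal{I}_{Q,k_2}(g)$ is the unique element of $\mathcal{H}_{2,m}$ agreeing with $g$ on $Q$. The expression $\nabla g(0)^\top(\cdot)$ denotes the linear function $x\mapsto \nabla g(0)^\top x=\sum_i \partial_i g(0)x_i$. *)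

theory Defs
  imports "HOL-Analysis.Analysis" "HOL-Library.Function_Algebras"
begin

section \<open>Function spaces on a domain\<close>

text \<open>A complex-valued function on a set \<open>D\<close> is represented by the total function that
  extends it by zero. With this convention functions on \<open>D\<close> are equal iff they agree on \<open>D\<close>,
  and the vector space operations are the pointwise ones of \<open>Function_Algebras\<close>.\<close>

definition functions_on :: "'a set \<Rightarrow> ('a \<Rightarrow> complex) set" where
  "functions_on D = {f. \<forall>x. x \<notin> D \<longrightarrow> f x = 0}"

definition on :: "'a set \<Rightarrow> ('a \<Rightarrow> complex) \<Rightarrow> 'a \<Rightarrow> complex" where
  "on D f = (\<lambda>x. if x \<in> D then f x else 0)"

definition scale_fun :: "complex \<Rightarrow> ('a \<Rightarrow> complex) \<Rightarrow> 'a \<Rightarrow> complex" where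
  "scale_fun c f = (\<lambda>x. c * f x)"

global_interpretation cfun: vector_space scale_fun
  by unfold_locales (auto simp: scale_fun_def fun_eq_iff algebra_simps)

text \<open>The internal sum. That the intersection of the summands is trivial is not part of the
  definition.\<close>

definition sum_space :: "('a \<Rightarrow> complex) set \<Rightarrow> ('a \<Rightarrow> complex) set \<Rightarrow> ('a \<Rightarrow> complex) set"
  (infixl "\<oplus>\<^sub>f" 65) where
  "V \<oplus>\<^sub>f W = {f + g |f g. f \<in> V \<and> g \<in> W}"

text \<open>The domain need not be open, so differentiability is taken within \<open>D\<close>.\<close>

definition C1 :: "(real^'n::finite) set \<Rightarrow> (real^'n \<Rightarrow> complex) set" where
  "C1 D = {f \<in> functions_on D. \<exists>f' :: real^'n \<Rightarrow> (real^'n) \<Rightarrow>\<^sub>L complex.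
     (\<forall>x\<in>D. (f has_derivative blinfun_apply (f' x)) (at x within D)) \<and> continuous_on D f'}"


section \<open>Reproducing kernel Hilbert spaces\<close>

text \<open>An inner product on a space of functions is given as a binary function whose values matter
  only on that space. It is linear in the first and conjugate-linear in the second argument,
  as forced by the reproducing property \<open>\<langle>f, k(x,\<cdot>)\<rangle> = f(x)\<close>.\<close>

type_synonym 'a inner_prod = "('a \<Rightarrow> complex) \<Rightarrow> ('a \<Rightarrow> complex) \<Rightarrow> complex"

definition ip_norm :: "'a inner_prod \<Rightarrow> ('a \<Rightarrow> complex) \<Rightarrow> real" where
  "ip_norm ip f = sqrt (Re (ip f f))"

definition inner_product_on :: "('a \<Rightarrow> complex) set \<Rightarrow> 'a inner_prod \<Rightarrow> bool" where
  "inner_product_on V ip \<longleftrightarrow>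
     (\<forall>f\<in>V. \<forall>g\<in>V. \<forall>h\<in>V. ip (f + g) h = ip f h + ip g h) \<and>
     (\<forall>c. \<forall>f\<in>V. \<forall>g\<in>V. ip (scale_fun c f) g = c * ip f g) \<and>
     (\<forall>f\<in>V. \<forall>g\<in>V. ip g f = cnj (ip f g)) \<and>
     (\<forall>f\<in>V. f \<noteq> 0 \<longrightarrow> Re (ip f f) > 0)"

definition complete_ip :: "('a \<Rightarrow> complex) set \<Rightarrow> 'a inner_prod \<Rightarrow> bool" where
  "complete_ip V ip \<longleftrightarrow>
     (\<forall>u :: nat \<Rightarrow> 'a \<Rightarrow> complex. (\<forall>n. u n \<in> V) \<and>
        (\<forall>e>0. \<exists>N. \<forall>m\<ge>N. \<forall>n\<ge>N. ip_norm ip (u m - u n) < e) \<longrightarrow>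
        (\<exists>f\<in>V. (\<lambda>n. ip_norm ip (u n - f)) \<longlonglongrightarrow> 0))"

definition hilbert_space :: "('a \<Rightarrow> complex) set \<Rightarrow> 'a inner_prod \<Rightarrow> bool" where
  "hilbert_space V ip \<longleftrightarrow> cfun.subspace V \<and> inner_product_on V ip \<and> complete_ip V ip"

definition rkhs :: "'a set \<Rightarrow> ('a \<Rightarrow> complex) set \<Rightarrow> 'a inner_prod \<Rightarrow> bool" where
  "rkhs D H ip \<longleftrightarrow> H \<subseteq> functions_on D \<and> hilbert_space H ip \<and>
     (\<forall>x\<in>D. \<exists>C. \<forall>f\<in>H. cmod (f x) \<le> C * ip_norm ip f)"

definition reproducing_kernel ::
    "'a set \<Rightarrow> ('a \<Rightarrow> 'a \<Rightarrow> complex) \<Rightarrow> ('a \<Rightarrow> complex) set \<Rightarrow> 'a inner_prod \<Rightarrow> bool" where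
  "reproducing_kernel D k H ip \<longleftrightarrow>
     (\<forall>x\<in>D. on D (k x) \<in> H \<and> (\<forall>f\<in>H. ip f (on D (k x)) = f x))"

definition rkhs_with_kernel ::
    "'a set \<Rightarrow> ('a \<Rightarrow> 'a \<Rightarrow> complex) \<Rightarrow> ('a \<Rightarrow> complex) set \<Rightarrow> 'a inner_prod \<Rightarrow> bool" where
  "rkhs_with_kernel D k H ip \<longleftrightarrow> rkhs D H ip \<and> reproducing_kernel D k H ip"

definition orthogonal_projection_in ::
    "('a \<Rightarrow> complex) set \<Rightarrow> 'a inner_prod \<Rightarrow> (('a \<Rightarrow> complex) \<Rightarrow> 'a \<Rightarrow> complex) \<Rightarrow> bool" where
  "orthogonal_projection_in V ip P \<longleftrightarrow>
     (\<forall>f\<in>V. P f \<in> V) \<and>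
     (\<forall>f\<in>V. \<forall>g\<in>V. P (f + g) = P f + P g) \<and>
     (\<forall>c. \<forall>f\<in>V. P (scale_fun c f) = scale_fun c (P f)) \<and>
     (\<forall>f\<in>V. P (P f) = P f) \<and>
     (\<forall>f\<in>V. \<forall>g\<in>V. ip (P f) g = ip f (P g))"


section \<open>Dynamical system and region of attraction\<close>

definition real_analytic_on :: "(real^'n::finite \<Rightarrow> real^'n) \<Rightarrow> (real^'n) set \<Rightarrow> bool" where
  "real_analytic_on F X \<longleftrightarrow>
     (\<forall>x\<in>X. \<exists>r>0. \<exists>c :: ('n \<Rightarrow> nat) \<Rightarrow> real^'n. \<forall>y\<in>ball x r.
        ((\<lambda>\<alpha>. (\<Prod>i\<in>UNIV. (y$i - x$i) ^ \<alpha> i) *\<^sub>R c \<alpha>) has_sum F y) UNIV)"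

definition solves_ode :: "(real^'n::finite \<Rightarrow> real^'n) \<Rightarrow> (real \<Rightarrow> real^'n) \<Rightarrow> real set \<Rightarrow> bool" where
  "solves_ode F u I \<longleftrightarrow> (\<forall>t\<in>I. (u has_vector_derivative F (u t)) (at t within I))"

text \<open>Solutions starting in \<open>X\<close> are not assumed to stay in \<open>X\<close> or to exist for all times:
  \<open>\<phi> t x\<close> is meaningful only as long as a solution from \<open>x\<close> exists.\<close>

definition flow_map :: "(real^'n::finite) set \<Rightarrow> (real^'n \<Rightarrow> real^'n) \<Rightarrow>
    (real \<Rightarrow> real^'n \<Rightarrow> real^'n) \<Rightarrow> bool" where
  "flow_map X F \<phi> \<longleftrightarrow>
     (\<forall>x\<in>X. \<phi> 0 x = x \<and>
        (\<forall>T\<ge>0. (\<exists>u. u 0 = x \<and> solves_ode F u {0..T}) \<longrightarrow> solves_ode F (\<lambda>t. \<phi> t x) {0..T}))"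

definition hyperbolic_equilibrium :: "(real^'n::finite \<Rightarrow> real^'n) \<Rightarrow> real^'n \<Rightarrow> bool" where
  "hyperbolic_equilibrium F x0 \<longleftrightarrow> F x0 = 0 \<and> F differentiable (at x0) \<and>
     (\<forall>(l::complex) (v::complex^'n). v \<noteq> 0 \<and>
        (\<chi> i j. complex_of_real (jacobian F (at x0) $ i $ j)) *v v = l *s v \<longrightarrow> Re l \<noteq> 0)"

definition locally_stable :: "(real^'n::finite) set \<Rightarrow> (real^'n \<Rightarrow> real^'n) \<Rightarrow>
    (real \<Rightarrow> real^'n \<Rightarrow> real^'n) \<Rightarrow> real^'n \<Rightarrow> bool" where
  "locally_stable X F \<phi> x0 \<longleftrightarrow>
     (\<forall>e>0. \<exists>d>0. \<forall>x\<in>X. dist x x0 < d \<longrightarrow>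
        solves_ode F (\<lambda>t. \<phi> t x) {0..} \<and> (\<forall>t\<ge>0. dist (\<phi> t x) x0 < e))"

definition region_of_attraction :: "(real^'n::finite) set \<Rightarrow> (real^'n \<Rightarrow> real^'n) \<Rightarrow>
    (real \<Rightarrow> real^'n \<Rightarrow> real^'n) \<Rightarrow> (real^'n) set" where
  "region_of_attraction X F \<phi> =
     {x \<in> X. solves_ode F (\<lambda>t. \<phi> t x) {0..} \<and> ((\<lambda>t. \<phi> t x) \<longlongrightarrow> 0) at_top}"


section \<open>The kernels and the operator \<open>\<Pi>\<close>\<close>

definition linear_kernel :: "real^'n::finite \<Rightarrow> real^'n \<Rightarrow> complex" where
  "linear_kernel x y = complex_of_real (x \<bullet> y)"

text \<open>The points \<open>q\<^sub>1, \<dots>, q\<^sub>m\<close> are indexed by a finite type \<open>'m\<close> with \<open>m = CARD('m)\<close>.\<close>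

definition gram :: "('a \<Rightarrow> 'a \<Rightarrow> complex) \<Rightarrow> ('m::finite \<Rightarrow> 'a) \<Rightarrow> complex^'m^'m" where
  "gram k q = (\<chi> i j. k (q i) (q j))"

definition interpolation :: "'a set \<Rightarrow> ('a \<Rightarrow> 'a \<Rightarrow> complex) \<Rightarrow> ('m::finite \<Rightarrow> 'a) \<Rightarrow>
    ('a \<Rightarrow> complex) \<Rightarrow> 'a \<Rightarrow> complex" where
  "interpolation D k q g =
     (let \<alpha> = (THE \<alpha>. gram k q *v \<alpha> = (\<chi> i. g (q i)))
      in on D (\<lambda>x. \<Sum>j\<in>UNIV. \<alpha> $ j * k x (q j)))"

definition gradient :: "(real^'n::finite \<Rightarrow> complex) \<Rightarrow> real^'n \<Rightarrow> complex^'n" where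
  "gradient g x = (\<chi> i. frechet_derivative g (at x) (axis i 1))"

definition linear_part :: "(real^'n::finite) set \<Rightarrow> (real^'n \<Rightarrow> complex) \<Rightarrow> real^'n \<Rightarrow> complex" where
  "linear_part D g = on D (\<lambda>x. \<Sum>i\<in>UNIV. gradient g 0 $ i * complex_of_real (x $ i))"

definition kernel_span :: "'a set \<Rightarrow> ('a \<Rightarrow> 'a \<Rightarrow> complex) \<Rightarrow> ('m::finite \<Rightarrow> 'a) \<Rightarrow>
    ('a \<Rightarrow> complex) set" where
  "kernel_span D k q = cfun.span (range (\<lambda>j. on D (\<lambda>x. k x (q j))))"

definition proj_op :: "(real^'n::finite) set \<Rightarrow> (real^'n \<Rightarrow> real^'n \<Rightarrow> complex) \<Rightarrow>
    ('m::finite \<Rightarrow> real^'n) \<Rightarrow> (real^'n \<Rightarrow> complex) \<Rightarrow> real^'n \<Rightarrow> complex" where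
  "proj_op D k q g = linear_part D g + interpolation D k q (g - linear_part D g)"

end

theory Submission
  imports Defs
begin

text \<open>In the space \<open>H\<close> with kernel \<open>k\<^sub>1 + k\<^sub>2\<close> the partial derivative at the origin is represented by
  a coordinate function: \<open>\<partial>\<^sub>i f(0) = \<langle>f, x\<^sub>i\<rangle>\<close>, because the kernel has linear part \<open>x \<bullet> y\<close> there. Hence
  the coordinate functions are orthonormal, \<open>f \<mapsto> \<nabla>f(0)\<^sup>T(\<cdot>)\<close> is the orthogonal projection onto their
  span, and on the orthogonal complement \<open>k\<^sub>2\<close> is reproducing. There the interpolation operator \<open>I\<close>
  is self-adjoint: \<open>g - I g\<close> vanishes at the nodes and is therefore orthogonal to every
  interpolant, so \<open>\<langle>I f, g\<rangle> = \<langle>I f, I g\<rangle> = \<langle>f, I g\<rangle>\<close>. That \<open>H\<^sub>1\<close> and \<open>H\<^sub>2\<close> lie in \<open>H\<close> follows since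
  a function of an RKHS is a pointwise limit of a Cauchy sequence in the span of its kernel
  functions.\<close>

section \<open>Inner products on function spaces\<close>

lemma sum_fun_apply: "(\<Sum>i\<in>A. f i) x = (\<Sum>i\<in>A. f i x)"
  for f :: "'b \<Rightarrow> 'a \<Rightarrow> complex"
  by (induction A rule: infinite_finite_induct) auto

lemma scale_fun_apply [simp]: "scale_fun c f x = c * f x"
  by (simp add: scale_fun_def)

locale ip_space =
  fixes V :: "('a \<Rightarrow> complex) set" and ip :: "'a inner_prod"
  assumes subspace: "cfun.subspace V" and ip: "inner_product_on V ip"
begin

section \<open>Sesquilinearity and the induced norm\<close>

lemmas closed [simp] = cfun.subspace_add [OF subspace] cfun.subspace_diff [OF subspace]
  cfun.subspace_scale [OF subspace] cfun.subspace_sum [OF subspace] cfun.subspace_0 [OF subspace]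

lemma ip_add_left: "f \<in> V \<Longrightarrow> g \<in> V \<Longrightarrow> h \<in> V \<Longrightarrow> ip (f + g) h = ip f h + ip g h"
  using ip [unfolded inner_product_on_def, THEN conjunct1] by simp

lemma ip_scale_left: "f \<in> V \<Longrightarrow> g \<in> V \<Longrightarrow> ip (scale_fun c f) g = c * ip f g"
  using ip [unfolded inner_product_on_def, THEN conjunct2, THEN conjunct1] by simp

lemma ip_cnj: "f \<in> V \<Longrightarrow> g \<in> V \<Longrightarrow> cnj (ip f g) = ip g f"
  using ip [unfolded inner_product_on_def, THEN conjunct2, THEN conjunct2, THEN conjunct1] by (metis complex_cnj_cnj)

lemma ip_pos: "f \<in> V \<Longrightarrow> f \<noteq> 0 \<Longrightarrow> Re (ip f f) > 0"
  using ip [unfolded inner_product_on_def, THEN conjunct2, THEN conjunct2, THEN conjunct2] by simp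

lemma ip_add_right: "f \<in> V \<Longrightarrow> g \<in> V \<Longrightarrow> h \<in> V \<Longrightarrow> ip h (f + g) = ip h f + ip h g"
  by (subst (1 2 3) ip_cnj [symmetric]) (auto simp: ip_add_left)

lemma ip_scale_right: "f \<in> V \<Longrightarrow> g \<in> V \<Longrightarrow> ip g (scale_fun c f) = cnj c * ip g f"
  by (subst (1 2) ip_cnj [symmetric]) (auto simp: ip_scale_left)

lemma ip_diff_left: "f \<in> V \<Longrightarrow> g \<in> V \<Longrightarrow> h \<in> V \<Longrightarrow> ip (f - g) h = ip f h - ip g h"
  using ip_add_left [of "f - g" g h] by simp

lemma ip_diff_right: "f \<in> V \<Longrightarrow> g \<in> V \<Longrightarrow> h \<in> V \<Longrightarrow> ip h (f - g) = ip h f - ip h g"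
  using ip_add_right [of "f - g" g h] by simp

lemma ip_zero_left: "g \<in> V \<Longrightarrow> ip 0 g = 0"
  using ip_add_left [of 0 0 g] by simp

lemma ip_zero_right: "g \<in> V \<Longrightarrow> ip g 0 = 0"
  using ip_add_right [of 0 0 g] by simp

lemma ip_sum_left:
  "(\<And>i. i \<in> A \<Longrightarrow> f i \<in> V) \<Longrightarrow> g \<in> V \<Longrightarrow> ip (\<Sum>i\<in>A. f i) g = (\<Sum>i\<in>A. ip (f i) g)"
  by (induction A rule: infinite_finite_induct) (auto simp: ip_zero_left ip_add_left)

lemma ip_sum_right:
  "(\<And>i. i \<in> A \<Longrightarrow> f i \<in> V) \<Longrightarrow> g \<in> V \<Longrightarrow> ip g (\<Sum>i\<in>A. f i) = (\<Sum>i\<in>A. ip g (f i))"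
  by (induction A rule: infinite_finite_induct) (auto simp: ip_zero_right ip_add_right)

lemma Re_ip_nonneg: "f \<in> V \<Longrightarrow> Re (ip f f) \<ge> 0"
  using ip_pos [of f] ip_zero_left [of 0] by (cases "f = 0") auto

lemma ip_self: "f \<in> V \<Longrightarrow> ip f f = of_real (Re (ip f f))"
  using ip_cnj [of f f] by (metis Reals_cnj_iff of_real_Re)

lemma Re_ip_commute: "f \<in> V \<Longrightarrow> g \<in> V \<Longrightarrow> Re (ip f g) = Re (ip g f)"
  by (metis ip_cnj complex_cnj_cnj cnj.simps(1))

lemma ip_norm_square: "f \<in> V \<Longrightarrow> (ip_norm ip f)\<^sup>2 = Re (ip f f)"
  unfolding ip_norm_def using Re_ip_nonneg by simp

lemma ip_norm_nonneg: "f \<in> V \<Longrightarrow> ip_norm ip f \<ge> 0"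
  unfolding ip_norm_def using Re_ip_nonneg by simp

lemma Re_ip_diff:
  "f \<in> V \<Longrightarrow> g \<in> V \<Longrightarrow> Re (ip (f - g) (f - g)) = Re (ip f f) - 2 * Re (ip f g) + Re (ip g g)"
  using Re_ip_commute [of f g] by (simp add: ip_diff_left ip_diff_right)

text \<open>For nonzero \<open>g\<close> the claim is the bound at the optimal coefficient
  \<open>c\<close>, the one that projects \<open>f\<close> onto \<open>g\<close>. With
  \<open>d = 0\<close> this is Cauchy-Schwarz; with \<open>d\<close> the squared distance to a
  subspace it says that an almost best approximation has an almost orthogonal error.\<close>

lemma cauchy_schwarz_gap:
  assumes "f \<in> V" "g \<in> V" and le: "\<And>c. d \<le> Re (ip (f - scale_fun c g) (f - scale_fun c g))"
  shows "(cmod (ip f g))\<^sup>2 \<le> (Re (ip f f) - d) * Re (ip g g)"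
proof (cases "g = 0")
  case True
  then show ?thesis using assms by (simp add: ip_zero_right)
next
  case False
  define G where "G = Re (ip g g)"
  have G: "G > 0" "ip g g = of_real G"
    using assms False ip_pos [of g] ip_self [of g] by (auto simp: G_def)
  define c where "c = ip f g / of_real G"
  have "ip (f - scale_fun c g) (f - scale_fun c g)
      = ip f f - cnj c * ip f g - c * ip g f + c * cnj c * ip g g"
    using assms by (simp add: ip_diff_left ip_diff_right ip_scale_left ip_scale_right algebra_simps)
  also have "\<dots> = ip f f - ip f g * cnj (ip f g) / of_real G"
    using assms G by (simp add: c_def ip_cnj field_simps)
  also have "\<dots> = ip f f - of_real ((cmod (ip f g))\<^sup>2 / G)"
    by (simp add: complex_norm_square [symmetric])
  finally have "d \<le> Re (ip f f) - (cmod (ip f g))\<^sup>2 / G"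
    using le [of c] by simp
  then show ?thesis
    using G by (simp add: G_def [symmetric] field_simps)
qed

lemma cauchy_schwarz:
  assumes "f \<in> V" "g \<in> V"
  shows "cmod (ip f g) \<le> ip_norm ip f * ip_norm ip g"
proof (rule power2_le_imp_le)
  show "(cmod (ip f g))\<^sup>2 \<le> (ip_norm ip f * ip_norm ip g)\<^sup>2"
    using cauchy_schwarz_gap [of f g 0] assms
    by (simp add: Re_ip_nonneg power_mult_distrib ip_norm_square)
qed (use assms ip_norm_nonneg in simp)

lemma tendsto_ip_left:
  assumes "\<And>n. u n \<in> V" "f \<in> V" "g \<in> V" and lim: "(\<lambda>n. ip_norm ip (u n - f)) \<longlonglongrightarrow> 0"
  shows "(\<lambda>n. ip (u n) g) \<longlonglongrightarrow> ip f g"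
proof -
  have "(\<lambda>n. ip (u n - f) g) \<longlonglongrightarrow> 0"
  proof (rule Lim_null_comparison)
    show "\<forall>\<^sub>F n in sequentially. cmod (ip (u n - f) g) \<le> ip_norm ip (u n - f) * ip_norm ip g"
      using assms by (simp add: cauchy_schwarz)
    show "(\<lambda>n. ip_norm ip (u n - f) * ip_norm ip g) \<longlonglongrightarrow> 0"
      using tendsto_mult_left_zero [OF lim] .
  qed
  then show ?thesis
    using assms by (simp add: ip_diff_left LIM_zero_iff)
qed

lemma tendsto_ip_right:
  assumes "\<And>n. u n \<in> V" "f \<in> V" "g \<in> V" and "(\<lambda>n. ip_norm ip (u n - f)) \<longlonglongrightarrow> 0"
  shows "(\<lambda>n. ip g (u n)) \<longlonglongrightarrow> ip g f"
  using tendsto_cnj [OF tendsto_ip_left [OF assms]] assms by (simp add: ip_cnj)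

text \<open>Unlike a best approximation itself, a minimising sequence exists without completeness,
  and by the gap inequality its error tends weakly to \<open>0\<close> on \<open>W\<close>.\<close>

lemma minimising_sequence:
  assumes W: "cfun.subspace W" "W \<subseteq> V" and f: "f \<in> V"
  obtains u where "\<And>n. u n \<in> W"
    "\<And>m n. Re (ip (u m - u n) (u m - u n)) \<le> 2 / real (Suc m) + 2 / real (Suc n)"
    "\<And>g. g \<in> W \<Longrightarrow> (\<lambda>n. ip (f - u n) g) \<longlonglongrightarrow> 0"
proof -
  define e where "e s = Re (ip (f - s) (f - s))" for s
  define d where "d = Inf (e ` W)"
  have [simp]: "s \<in> W \<Longrightarrow> s \<in> V" for s using W by auto
  have bdd: "bdd_below (e ` W)"
    using f by (auto intro!: bdd_belowI [of _ 0] Re_ip_nonneg simp: e_def)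
  have d_le: "d \<le> e s" if "s \<in> W" for s
    using bdd that by (auto simp: d_def intro: cInf_lower)
  have "\<exists>s\<in>W. e s < d + 1 / real (Suc n)" for n
    using cInf_lessD [of "e ` W" "d + 1 / real (Suc n)"] cfun.subspace_0 [OF W(1)]
    by (auto simp: d_def)
  then obtain u where u: "\<And>n. u n \<in> W" "\<And>n. e (u n) < d + 1 / real (Suc n)"
    by metis
  have uV [simp]: "u n \<in> V" for n using u by simp
  show thesis
  proof (rule that [of u])
    fix m n
    define a where "a = f - u m"
    define b where "b = f - u n"
    have ab: "a \<in> V" "b \<in> V" using f by (auto simp: a_def b_def)
    \<comment> \<open>Parallelogram law for the errors \<open>a\<close> and \<open>b\<close>: the
      midpoint \<open>s\<close> of \<open>u m\<close> and \<open>u n\<close> stays in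
      \<open>W\<close>, so its squared error is at least \<open>d\<close>, while the squared norms
      of \<open>a\<close> and \<open>b\<close> barely exceed \<open>d\<close>.\<close>
    define s where "s = scale_fun (1 / 2) (u m + u n)"
    have s: "s \<in> W"
      using W(1) u by (auto simp: s_def intro!: cfun.subspace_scale cfun.subspace_add)
    have "f - s = scale_fun (1 / 2) (a + b)"
      by (auto simp: fun_eq_iff s_def a_def b_def field_simps)
    then have "4 * e s = Re (ip a a) + 2 * Re (ip a b) + Re (ip b b)"
      using ab Re_ip_commute [of a b]
      by (simp add: e_def ip_scale_left ip_scale_right ip_add_left ip_add_right field_simps)
    moreover have "u m - u n = b - a" by (simp add: a_def b_def)
    ultimately have "Re (ip (u m - u n) (u m - u n)) = 2 * e (u m) + 2 * e (u n) - 4 * e s"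
      using ab Re_ip_commute [of a b]
      by (simp add: Re_ip_diff) (simp add: e_def a_def b_def)
    then show "Re (ip (u m - u n) (u m - u n)) \<le> 2 / real (Suc m) + 2 / real (Suc n)"
      using d_le [OF s] u(2) [of m] u(2) [of n]
        times_divide_eq_right [of 2 1 "real (Suc m)"] times_divide_eq_right [of 2 1 "real (Suc n)"]
      by linarith
  next
    fix g assume g: "g \<in> W"
    have "(cmod (ip (f - u n) g))\<^sup>2 \<le> 1 / real (Suc n) * Re (ip g g)" for n
    proof -
      \<comment> \<open>Correcting \<open>u n\<close> by a multiple of \<open>g\<close> stays in
        \<open>W\<close> and cannot bring the squared error below \<open>d\<close>; this is the
        premise of the gap inequality.\<close>
      have "d \<le> Re (ip (f - u n - scale_fun c g) (f - u n - scale_fun c g))" for c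
        using d_le [of "u n + scale_fun c g"] u g W(1)
        by (simp add: e_def diff_diff_eq cfun.subspace_add cfun.subspace_scale)
      then have "(cmod (ip (f - u n) g))\<^sup>2 \<le> (e (u n) - d) * Re (ip g g)"
        using cauchy_schwarz_gap [of "f - u n" g d] f g by (simp add: e_def)
      also have "\<dots> \<le> 1 / real (Suc n) * Re (ip g g)"
        using u(2) [of n] g Re_ip_nonneg by (intro mult_right_mono) auto
      finally show ?thesis .
    qed
    moreover have "(\<lambda>n. 1 / real (Suc n) * Re (ip g g)) \<longlonglongrightarrow> 0"
      using tendsto_mult_left_zero [OF LIMSEQ_inverse_real_of_nat] by (simp add: inverse_eq_divide)
    ultimately have "(\<lambda>n. (cmod (ip (f - u n) g))\<^sup>2) \<longlonglongrightarrow> 0"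
      by (intro Lim_null_comparison [of "\<lambda>n. (cmod (ip (f - u n) g))\<^sup>2"]) (auto intro: always_eventually)
    then show "(\<lambda>n. ip (f - u n) g) \<longlonglongrightarrow> 0"
      by (simp add: tendsto_norm_zero_iff)
  qed (use u in auto)
qed

end

section \<open>Reproducing kernel Hilbert spaces\<close>

lemma rkhs_ip_space: "rkhs D H ip \<Longrightarrow> ip_space H ip"
  by (simp add: rkhs_def hilbert_space_def ip_space_def)

lemma rkhs_outside: "rkhs D H ip \<Longrightarrow> f \<in> H \<Longrightarrow> x \<notin> D \<Longrightarrow> f x = 0"
  by (auto simp: rkhs_def functions_on_def)

text \<open>Evaluation at \<open>x\<close> is bounded by a multiple of the norm, so convergence in
  norm forces convergence at each point of \<open>D\<close>.\<close>

lemma rkhs_tendsto_eval: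
  assumes H: "rkhs D H ip" and u: "\<And>n. u n \<in> H" and "f \<in> H" "x \<in> D"
    and lim: "(\<lambda>n. ip_norm ip (u n - f)) \<longlonglongrightarrow> 0"
  shows "(\<lambda>n. u n x) \<longlonglongrightarrow> f x"
proof -
  interpret ip_space H ip using H by (rule rkhs_ip_space)
  have "\<exists>C. \<forall>f\<in>H. cmod (f x) \<le> C * ip_norm ip f"
    using H \<open>x \<in> D\<close> by (simp add: rkhs_def)
  then obtain C where C: "\<forall>f\<in>H. cmod (f x) \<le> C * ip_norm ip f" ..
  have "(\<lambda>n. (u n - f) x) \<longlonglongrightarrow> 0"
  proof (rule Lim_null_comparison)
    show "\<forall>\<^sub>F n in sequentially. cmod ((u n - f) x) \<le> C * ip_norm ip (u n - f)"
      by (intro always_eventually allI bspec [OF C] closed u \<open>f \<in> H\<close>)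
    show "(\<lambda>n. C * ip_norm ip (u n - f)) \<longlonglongrightarrow> 0"
      using tendsto_mult_right_zero [OF lim] .
  qed
  then show ?thesis by (simp add: LIM_zero_iff)
qed

text \<open>Completeness in the form used below: for minimising sequences and for difference
  quotients the squared distances are bounded by a sum of two null sequences.\<close>

lemma rkhs_cauchy_limit:
  assumes H: "rkhs D H ip" and u: "\<And>n. u n \<in> H"
    and b: "b \<longlonglongrightarrow> 0" "\<And>m n. Re (ip (u m - u n) (u m - u n)) \<le> b m + b n"
  obtains f where "f \<in> H" "(\<lambda>n. ip_norm ip (u n - f)) \<longlonglongrightarrow> 0"
proof -
  have "\<exists>N. \<forall>m\<ge>N. \<forall>n\<ge>N. ip_norm ip (u m - u n) < e" if "e > 0" for e :: real
  proof -
    have "\<forall>\<^sub>F n in sequentially. b n < e\<^sup>2 / 2"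
      using b(1) that by (intro order_tendstoD) auto
    then obtain N where N: "\<And>n. n \<ge> N \<Longrightarrow> b n < e\<^sup>2 / 2"
      by (auto simp: eventually_sequentially)
    have "ip_norm ip (u m - u n) < e" if mn: "m \<ge> N" "n \<ge> N" for m n
    proof -
      have "Re (ip (u m - u n) (u m - u n)) < e\<^sup>2"
        using b(2) [of m n] N [OF mn(1)] N [OF mn(2)] by simp
      then show ?thesis
        unfolding ip_norm_def using \<open>e > 0\<close> by (intro real_less_lsqrt) auto
    qed
    then show ?thesis by blast
  qed
  moreover have "complete_ip H ip"
    using H by (simp add: rkhs_def hilbert_space_def)
  ultimately show thesis
    using u that unfolding complete_ip_def by blast
qed

text \<open>A function \<open>f\<close> of \<open>H\<close> is a pointwise limit of a Cauchy sequence in the span of the kernel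
  functions, and on this span both inner products agree.\<close>

lemma rkhs_subset:
  assumes k: "rkhs_with_kernel D k H ip" and G: "rkhs D G jp"
    and kG: "\<And>x. x \<in> D \<Longrightarrow> on D (k x) \<in> G"
    and jp: "\<And>x y. x \<in> D \<Longrightarrow> y \<in> D \<Longrightarrow> jp (on D (k x)) (on D (k y)) = k x y"
  shows "H \<subseteq> G"
proof
  fix f assume f: "f \<in> H"
  define K where "K = (\<lambda>x. on D (k x)) ` D"
  have H: "rkhs D H ip" and kH: "\<And>x. x \<in> D \<Longrightarrow> on D (k x) \<in> H"
    and rep: "\<And>x g. x \<in> D \<Longrightarrow> g \<in> H \<Longrightarrow> ip g (on D (k x)) = g x"
    using k by (auto simp: rkhs_with_kernel_def reproducing_kernel_def)
  interpret H: ip_space H ip using H by (rule rkhs_ip_space)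
  interpret G: ip_space G jp using G by (rule rkhs_ip_space)
  have KH: "cfun.span K \<subseteq> H" and KG: "cfun.span K \<subseteq> G"
    using cfun.span_minimal [OF _ H.subspace, of K] cfun.span_minimal [OF _ G.subspace, of K] kH kG
    unfolding K_def by blast+
  \<comment> \<open>On the span \<open>jp\<close> reproduces values: it does so on the kernel
    functions by hypothesis, and both sides are linear in \<open>h\<close>.\<close>
  have base: "jp h (on D (k y)) = h y" if "h \<in> cfun.span K" and y: "y \<in> D" for h y
  proof -
    have "cfun.subspace {h \<in> G. jp h (on D (k y)) = h y}"
      using kG [OF y]
      by (auto intro!: cfun.subspaceI simp: G.ip_zero_left G.ip_add_left G.ip_scale_left)
    moreover have "K \<subseteq> {h \<in> G. jp h (on D (k y)) = h y}"
      using kG jp y by (auto simp: K_def) (simp add: on_def)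
    ultimately show ?thesis
      using cfun.span_minimal \<open>h \<in> cfun.span K\<close> by blast
  qed
  \<comment> \<open>For fixed \<open>h\<close> both sides are conjugate-linear in \<open>g\<close>,
    and on each kernel function both equal the value of \<open>h\<close>.\<close>
  have agree: "jp h g = ip h g" if "g \<in> cfun.span K" and h: "h \<in> cfun.span K" for h g
  proof -
    have hGH: "h \<in> G" "h \<in> H" using h KG KH by auto
    then have "cfun.subspace {g \<in> G \<inter> H. jp h g = ip h g}"
      by (auto intro!: cfun.subspaceI simp: G.ip_zero_right G.ip_add_right G.ip_scale_right
          H.ip_zero_right H.ip_add_right H.ip_scale_right)
    moreover have "K \<subseteq> {g \<in> G \<inter> H. jp h g = ip h g}"
      using kG kH base [OF h] rep [OF _ hGH(2)] by (auto simp: K_def)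
    ultimately show ?thesis
      using cfun.span_minimal \<open>g \<in> cfun.span K\<close> by blast
  qed
  obtain u where u: "\<And>n. u n \<in> cfun.span K"
    and cauchy: "\<And>m n. Re (ip (u m - u n) (u m - u n)) \<le> 2 / real (Suc m) + 2 / real (Suc n)"
    and weak: "\<And>g. g \<in> cfun.span K \<Longrightarrow> (\<lambda>n. ip (f - u n) g) \<longlonglongrightarrow> 0"
    by (rule H.minimising_sequence [OF cfun.subspace_span KH f]) (rule that)
  have uH: "u n \<in> H" and uG: "u n \<in> G" for n
    by (rule subsetD [OF KH u], rule subsetD [OF KG u])
  \<comment> \<open>Weak convergence tested against a kernel function is pointwise convergence, by
    the reproducing property.\<close>
  have lim_f: "(\<lambda>n. u n x) \<longlonglongrightarrow> f x" if "x \<in> D" for x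
  proof -
    have "(\<lambda>n. ip (f - u n) (on D (k x))) \<longlonglongrightarrow> 0"
      using that by (intro weak cfun.span_base) (auto simp: K_def)
    then have "(\<lambda>n. f x - u n x) \<longlonglongrightarrow> 0"
      using rep that f uH by simp
    then show ?thesis
      using tendsto_diff [of "\<lambda>_. f x" "f x" sequentially "\<lambda>n. f x - u n x" 0] by simp
  qed
  have b: "(\<lambda>n. 2 / real (Suc n)) \<longlonglongrightarrow> 0"
    using tendsto_mult_right_zero [OF LIMSEQ_inverse_real_of_nat, of 2]
    by (simp add: inverse_eq_divide)
  \<comment> \<open>The differences stay in the span, where the two products agree. So the sequence
    is Cauchy in \<open>G\<close> as well, and its limit there has the values of
    \<open>f\<close>.\<close>
  have "Re (jp (u m - u n) (u m - u n)) \<le> 2 / real (Suc m) + 2 / real (Suc n)" for m n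
    using cauchy [of m n] u by (subst agree) (auto intro: cfun.span_diff)
  then obtain p where p: "p \<in> G" "(\<lambda>n. ip_norm jp (u n - p)) \<longlonglongrightarrow> 0"
    by (rule rkhs_cauchy_limit [OF G uG b])
  have "f x = p x" if "x \<in> D" for x
    by (rule LIMSEQ_unique [OF lim_f [OF that] rkhs_tendsto_eval [OF G uG p(1) that p(2)]])
  moreover have "f x = p x" if "x \<notin> D" for x
    using that rkhs_outside [OF H f] rkhs_outside [OF G p(1)] by simp
  ultimately have "f = p" by blast
  then show "f \<in> G" using p by simp
qed

section \<open>Representation of the derivative at the origin\<close>

text \<open>Scaling \<open>c\<close> by \<open>\<tau>\<close> multiplies the term of degree
  \<open>k\<close> by \<open>\<tau> ^ k\<close>. As degree 1 is missing, everything beyond the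
  constant term has degree at least 2 and is of order \<open>\<tau>\<^sup>2\<close>, with the
  absolute sum at \<open>c\<close> as the constant.\<close>

lemma power_sum_remainder:
  fixes c :: real
  assumes "((\<lambda>k. complex_of_real (a k * c ^ k)) has_sum s) (UNIV - {1})"
  obtains C where "C \<ge> 0"
    "\<And>\<tau> s'. \<bar>\<tau>\<bar> \<le> 1 \<Longrightarrow> ((\<lambda>k. complex_of_real (a k * (\<tau> * c) ^ k)) has_sum s') (UNIV - {1}) \<Longrightarrow>
      cmod (s' - of_real (a 0)) \<le> \<tau>\<^sup>2 * C"
proof -
  define B where "B = UNIV - {0, 1 :: nat}"
  have B: "UNIV - {1} = insert 0 B" "0 \<notin> B" by (auto simp: B_def)
  define C where "C = infsum (\<lambda>k. cmod (of_real (a k * c ^ k))) B"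
  have "(\<lambda>k. complex_of_real (a k * c ^ k)) summable_on B"
    using has_sum_imp_summable [OF assms] summable_on_subset_banach B by blast
  \<comment> \<open>Summability of a complex family is the same as absolute summability.\<close>
  then have C: "((\<lambda>k. cmod (of_real (a k * c ^ k))) has_sum C) B"
    unfolding C_def summable_on_iff_abs_summable_on_complex by (rule has_sum_infsum)
  show thesis
  proof (rule that [of C])
    show "C \<ge> 0" unfolding C_def by (rule infsum_nonneg) simp
    fix \<tau> s'
    assume \<tau>: "\<bar>\<tau>\<bar> \<le> 1"
      and s': "((\<lambda>k. complex_of_real (a k * (\<tau> * c) ^ k)) has_sum s') (UNIV - {1})"
    have "((\<lambda>k. complex_of_real (a k * (\<tau> * c) ^ k)) has_sum (s' - of_real (a 0))) B"
    proof -
      have "((\<lambda>k. complex_of_real (a k * (\<tau> * c) ^ k)) has_sum (s' - of_real (a 0)))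
        (UNIV - {1} - {0})"
        by (intro has_sum_Diff s' has_sum_finiteI) auto
      moreover have "UNIV - {1} - {0} = B" by (auto simp: B_def)
      ultimately show ?thesis by simp
    qed
    then show "cmod (s' - of_real (a 0)) \<le> \<tau>\<^sup>2 * C"
    proof (rule norm_infsum_le)
      show "((\<lambda>k. \<tau>\<^sup>2 * cmod (of_real (a k * c ^ k))) has_sum \<tau>\<^sup>2 * C) B"
        by (rule has_sum_cmult_right [OF C])
      fix k assume "k \<in> B"
      then have "k \<ge> 2" by (auto simp: B_def)
      then have "\<bar>\<tau>\<bar> ^ k \<le> \<tau>\<^sup>2"
        using power_decreasing [of 2 k "\<bar>\<tau>\<bar>"] \<tau> by simp
      then have "\<bar>\<tau>\<bar> ^ k * \<bar>a k * c ^ k\<bar> \<le> \<tau>\<^sup>2 * \<bar>a k * c ^ k\<bar>"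
        by (intro mult_right_mono) auto
      then show "cmod (of_real (a k * (\<tau> * c) ^ k)) \<le> \<tau>\<^sup>2 * cmod (of_real (a k * c ^ k))"
        unfolding norm_of_real by (simp add: abs_mult power_abs power_mult_distrib mult_ac)
    qed
  qed
qed

text \<open>The remainder divided by the norm of \<open>t n *\<^sub>R e\<close> tends to 0;
  multiplying by the norm of \<open>e\<close> gives the error of the difference quotient. Dividing
  by that norm is why \<open>e = 0\<close> is a separate case.\<close>

lemma has_derivative_tendsto_quotient:
  fixes f :: "'a::real_normed_vector \<Rightarrow> complex"
  assumes f: "(f has_derivative f') (at x)" and t: "t \<longlonglongrightarrow> 0" "\<And>n. t n \<noteq> 0"
  shows "(\<lambda>n. (f (x + t n *\<^sub>R e) - f x) / of_real (t n)) \<longlonglongrightarrow> f' e"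
proof (cases "e = 0")
  case True
  then show ?thesis using has_derivative_linear [OF f] by (simp add: linear_0)
next
  case False
  have lin: "f' (c *\<^sub>R e) = of_real c * f' e" for c
    using has_derivative_linear [OF f] by (simp add: linear_scale scaleR_conv_of_real)
  have "filterlim (\<lambda>n. t n *\<^sub>R e) (at 0) sequentially"
    using tendsto_scaleR [OF t(1) tendsto_const, of e] t(2) False by (simp add: filterlim_at)
  moreover have "((\<lambda>h. norm (f (x + h) - f x - f' h) / norm h) \<longlongrightarrow> 0) (at 0)"
    using f by (simp add: has_derivative_at)
  ultimately have "(\<lambda>n. norm (f (x + t n *\<^sub>R e) - f x - f' (t n *\<^sub>R e)) / norm (t n *\<^sub>R e)) \<longlonglongrightarrow> 0"
    by (rule filterlim_compose [rotated])
  then have "(\<lambda>n. norm e * (norm (f (x + t n *\<^sub>R e) - f x - f' (t n *\<^sub>R e)) / norm (t n *\<^sub>R e)))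
      \<longlonglongrightarrow> 0"
    by (rule tendsto_mult_right_zero)
  also have "(\<lambda>n. norm e * (norm (f (x + t n *\<^sub>R e) - f x - f' (t n *\<^sub>R e)) / norm (t n *\<^sub>R e)))
      = (\<lambda>n. norm ((f (x + t n *\<^sub>R e) - f x) / of_real (t n) - f' e))"
  proof
    fix n
    have "(f (x + t n *\<^sub>R e) - f x) / of_real (t n) - f' e
        = (f (x + t n *\<^sub>R e) - f x - f' (t n *\<^sub>R e)) / of_real (t n)"
      using t(2) [of n] by (simp add: lin field_simps)
    then show "norm e * (norm (f (x + t n *\<^sub>R e) - f x - f' (t n *\<^sub>R e)) / norm (t n *\<^sub>R e))
        = norm ((f (x + t n *\<^sub>R e) - f x) / of_real (t n) - f' e)"
      using False by (simp add: norm_divide)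
  qed
  finally show ?thesis
    by (simp add: tendsto_norm_zero_iff LIM_zero_iff)
qed

definition coord :: "(real^'n::finite) set \<Rightarrow> 'n \<Rightarrow> real^'n \<Rightarrow> complex" where
  "coord D i = on D (\<lambda>x. of_real (x $ i))"

text \<open>The difference quotients of the kernel functions at the origin form a Cauchy sequence, whose
  limit is a coordinate function.\<close>

lemma coord_represents_derivative:
  fixes R :: "(real^'n::finite) set"
  assumes ball: "r > 0" "ball 0 r \<subseteq> R"
    and k2: "\<And>x y. x \<in> R \<Longrightarrow> y \<in> R \<Longrightarrow>
           ((\<lambda>k. complex_of_real (a k * (x \<bullet> y) ^ k)) has_sum k2 x y) (UNIV - {1})"
    and H: "rkhs_with_kernel R (\<lambda>x y. linear_kernel x y + k2 x y) H ip"
  shows "coord R i \<in> H"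
    and "\<And>f f'. f \<in> H \<Longrightarrow> (f has_derivative f') (at 0) \<Longrightarrow> ip f (coord R i) = f' (axis i 1)"
proof -
  define \<kappa> where "\<kappa> x y = linear_kernel x y + k2 x y" for x y
  have H: "rkhs R H ip" and \<kappa>H: "\<And>x. x \<in> R \<Longrightarrow> on R (\<kappa> x) \<in> H"
    and rep: "\<And>x g. x \<in> R \<Longrightarrow> g \<in> H \<Longrightarrow> ip g (on R (\<kappa> x)) = g x"
    using H by (auto simp: rkhs_with_kernel_def reproducing_kernel_def \<kappa>_def [abs_def])
  interpret ip_space H ip using H by (rule rkhs_ip_space)
  \<comment> \<open>The pair \<open>x\<close>, \<open>y\<close> serves as a fixed reference at which
    the series is known to converge; the constant is uniform over all pairs whose inner product is a
    fraction \<open>\<tau>\<close> of theirs.\<close>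
  have remainder: "\<exists>C\<ge>0. \<forall>\<tau> x' y'. \<bar>\<tau>\<bar> \<le> 1 \<and> x' \<in> R \<and> y' \<in> R \<and> x' \<bullet> y' = \<tau> * (x \<bullet> y) \<longrightarrow>
      cmod (k2 x' y' - of_real (a 0)) \<le> \<tau>\<^sup>2 * C" if xy: "x \<in> R" "y \<in> R" for x y
  proof -
    obtain C where C: "C \<ge> 0" "\<And>\<tau> s'. \<bar>\<tau>\<bar> \<le> 1 \<Longrightarrow>
        ((\<lambda>k. complex_of_real (a k * (\<tau> * (x \<bullet> y)) ^ k)) has_sum s') (UNIV - {1}) \<Longrightarrow>
        cmod (s' - of_real (a 0)) \<le> \<tau>\<^sup>2 * C"
      by (rule power_sum_remainder [OF k2 [OF xy]]) (rule that)
    show ?thesis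
    proof (intro exI conjI allI impI)
      fix \<tau> x' y'
      assume *: "\<bar>\<tau>\<bar> \<le> 1 \<and> x' \<in> R \<and> y' \<in> R \<and> x' \<bullet> y' = \<tau> * (x \<bullet> y)"
      then show "cmod (k2 x' y' - of_real (a 0)) \<le> \<tau>\<^sup>2 * C"
        by (intro C(2)) (use k2 [of x' y'] * in simp_all)
    qed (rule C(1))
  qed
  have zero: "0 \<in> R" using ball by auto
  \<comment> \<open>With \<open>\<tau> = 0\<close> the remainder bound vanishes, so only the
    constant term is left.\<close>
  have k2_zero: "k2 x 0 = of_real (a 0)" "k2 0 x = of_real (a 0)" if "x \<in> R" for x
  proof -
    obtain C where "\<And>\<tau> x' y'. \<bar>\<tau>\<bar> \<le> 1 \<Longrightarrow> x' \<in> R \<Longrightarrow> y' \<in> R \<Longrightarrow>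
        x' \<bullet> y' = \<tau> * (0 \<bullet> (0::real^'n)) \<Longrightarrow> cmod (k2 x' y' - of_real (a 0)) \<le> \<tau>\<^sup>2 * C"
      using remainder [OF zero zero] by blast
    from this [of 0 x 0] this [of 0 0 x]
    show "k2 x 0 = of_real (a 0)" "k2 0 x = of_real (a 0)"
      using that zero by auto
  qed
  define e :: "real^'n" where "e = axis i 1"
  have e: "e $ i = 1" "norm e = 1" "e \<bullet> x = x $ i" for x
    by (auto simp: e_def inner_axis' inner_axis_axis)
  \<comment> \<open>Half the radius keeps \<open>\<rho> *\<^sub>R e\<close> inside the ball. The
    step length is \<open>t n = \<rho> * \<sigma> n\<close>, so the points \<open>y n\<close> are
    this reference point scaled by \<open>\<sigma> n \<le> 1\<close>.\<close>
  define \<rho> where "\<rho> = r / 2"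
  define \<sigma> where "\<sigma> n = inverse (real (Suc n))" for n
  have \<sigma>: "\<sigma> n > 0" "\<sigma> n \<le> 1" for n by (auto simp: \<sigma>_def field_simps)
  have \<sigma>_lim: "\<sigma> \<longlonglongrightarrow> 0"
    unfolding \<sigma>_def by (rule LIMSEQ_inverse_real_of_nat)
  have \<rho>: "\<rho> > 0" using ball by (simp add: \<rho>_def)
  define t where "t n = \<rho> * \<sigma> n" for n
  have t: "t n > 0" for n using \<rho> \<sigma> by (simp add: t_def)
  have t_lim: "t \<longlonglongrightarrow> 0"
    unfolding t_def using tendsto_mult_right_zero [OF \<sigma>_lim] .
  have e_mem: "(c * \<rho>) *\<^sub>R e \<in> R" if "0 \<le> c" "c \<le> 1" for c
  proof -
    have "c * \<rho> < r"
      using mult_right_mono [OF that(2), of \<rho>] \<rho> by (simp add: \<rho>_def)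
    then show ?thesis using ball \<rho> that e by (auto simp: abs_mult)
  qed
  have \<rho>e: "\<rho> *\<^sub>R e \<in> R" using e_mem [of 1] by simp
  define y where "y n = t n *\<^sub>R e" for n
  have y: "y n \<in> R" for n
    using e_mem [of "\<sigma> n"] \<sigma> [of n] by (simp add: y_def t_def mult.commute)
  \<comment> \<open>By the reproducing property, the product with \<open>u n\<close> is the
    difference quotient at the origin in direction \<open>e\<close>.\<close>
  define u where "u n = scale_fun (1 / of_real (t n)) (on R (\<kappa> (y n)) - on R (\<kappa> 0))" for n
  have uH: "u n \<in> H" for n using \<kappa>H y zero by (simp add: u_def)
  have ip_u: "ip f (u n) = (f (y n) - f 0) / of_real (t n)" if "f \<in> H" for f n
    using that \<kappa>H y zero by (simp add: u_def ip_scale_right ip_diff_right rep)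
  obtain C where C: "C \<ge> 0" "\<And>\<tau> x' y'. \<bar>\<tau>\<bar> \<le> 1 \<Longrightarrow> x' \<in> R \<Longrightarrow> y' \<in> R \<Longrightarrow>
      x' \<bullet> y' = \<tau> * ((\<rho> *\<^sub>R e) \<bullet> (\<rho> *\<^sub>R e)) \<Longrightarrow> cmod (k2 x' y' - of_real (a 0)) \<le> \<tau>\<^sup>2 * C"
    using remainder [OF \<rho>e \<rho>e] by blast
  \<comment> \<open>This is a mixed difference quotient of the kernel: the linear kernel contributes
    exactly 1, the constant term of \<open>k2\<close> cancels, and the remainder bound controls the
    rest.\<close>
  have gram_u: "cmod (ip (u m) (u n) - 1) \<le> \<sigma> m * \<sigma> n * (C / \<rho>\<^sup>2)" for m n
  proof -
    have "ip (u m) (u n) = 1 + (k2 (y m) (y n) - of_real (a 0)) / (of_real (t m) * of_real (t n))"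
      using t [of m] t [of n] y zero
      by (simp add: ip_u [OF uH]) (simp add: u_def on_def \<kappa>_def linear_kernel_def k2_zero y_def e field_simps)
    moreover have "cmod (k2 (y m) (y n) - of_real (a 0)) \<le> (\<sigma> m * \<sigma> n)\<^sup>2 * C"
    proof (rule C(2))
      show "\<bar>\<sigma> m * \<sigma> n\<bar> \<le> 1"
        using \<sigma> [of m] \<sigma> [of n] by (simp add: abs_mult mult_le_one)
      show "y m \<bullet> y n = \<sigma> m * \<sigma> n * ((\<rho> *\<^sub>R e) \<bullet> (\<rho> *\<^sub>R e))"
        by (simp add: y_def t_def e)
    qed (use y in auto)
    then have "cmod (k2 (y m) (y n) - of_real (a 0)) / (t m * t n) \<le> (\<sigma> m * \<sigma> n)\<^sup>2 * C / (t m * t n)"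
      using t [of m] t [of n] by (intro divide_right_mono) auto
    moreover have "(\<sigma> m * \<sigma> n)\<^sup>2 * C / (t m * t n) = \<sigma> m * \<sigma> n * (C / \<rho>\<^sup>2)"
      using \<sigma> [of m] \<sigma> [of n] \<rho> by (simp add: t_def power2_eq_square field_simps)
    ultimately show ?thesis
      using t [of m] t [of n] by (simp add: norm_divide norm_mult)
  qed
  define K where "K = C / \<rho>\<^sup>2"
  have K: "K \<ge> 0" using C(1) by (simp add: K_def)
  define M where "M = 2 * K"
  have b: "(\<lambda>n. M * (\<sigma> n)\<^sup>2) \<longlonglongrightarrow> 0"
    using tendsto_mult_right_zero [OF tendsto_null_power [OF \<sigma>_lim]] by simp
  \<comment> \<open>In the expanded square the constants \<open>1 - 2 + 1\<close> cancel, which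
    leaves \<open>(\<sigma> m + \<sigma> n)\<^sup>2 * K\<close>; the factor 2 in \<open>M\<close>
    pays for separating \<open>m\<close> from \<open>n\<close>.\<close>
  have cauchy: "Re (ip (u m - u n) (u m - u n)) \<le> M * (\<sigma> m)\<^sup>2 + M * (\<sigma> n)\<^sup>2" for m n
  proof -
    have bd: "\<bar>Re (ip (u j) (u l)) - 1\<bar> \<le> \<sigma> j * \<sigma> l * K" for j l
      using abs_Re_le_cmod [of "ip (u j) (u l) - 1"] gram_u [of j l] by (simp add: K_def)
    have "Re (ip (u m - u n) (u m - u n)) \<le> (\<sigma> m + \<sigma> n)\<^sup>2 * K"
      unfolding Re_ip_diff [OF uH uH] using bd [of m m] bd [of m n] bd [of n n]
      by (simp add: power2_eq_square distrib_left distrib_right abs_le_iff mult.commute)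
    also have "\<dots> \<le> (2 * (\<sigma> m)\<^sup>2 + 2 * (\<sigma> n)\<^sup>2) * K"
      using K sum_squares_bound [of "\<sigma> m" "\<sigma> n"]
      by (intro mult_right_mono) (auto simp: power2_eq_square algebra_simps)
    finally show ?thesis by (simp add: M_def algebra_simps)
  qed
  obtain w where w: "w \<in> H" "(\<lambda>n. ip_norm ip (u n - w)) \<longlonglongrightarrow> 0"
    by (rule rkhs_cauchy_limit [OF H uH b cauchy])
  \<comment> \<open>The limit is identified pointwise: at \<open>x\<close> the linear kernel
    contributes \<open>x $ i\<close> to \<open>u n x\<close>, and the remainder, now with reference
    pair \<open>\<rho> *\<^sub>R e\<close> and \<open>x\<close>, is of order
    \<open>\<sigma> n\<close>.\<close>
  have "w = coord R i"
  proof
    fix x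
    show "w x = coord R i x"
    proof (cases "x \<in> R")
      case False
      then show ?thesis
        using rkhs_outside [OF H w(1)] by (simp add: coord_def on_def)
    next
      case True
      obtain C where C: "C \<ge> 0" "\<And>\<tau> x' y'. \<bar>\<tau>\<bar> \<le> 1 \<Longrightarrow> x' \<in> R \<Longrightarrow> y' \<in> R \<Longrightarrow>
          x' \<bullet> y' = \<tau> * ((\<rho> *\<^sub>R e) \<bullet> x) \<Longrightarrow> cmod (k2 x' y' - of_real (a 0)) \<le> \<tau>\<^sup>2 * C"
        using remainder [OF \<rho>e True] by blast
      have "(\<lambda>n. u n x - of_real (x $ i)) \<longlonglongrightarrow> 0"
      proof (rule Lim_null_comparison)
        show "(\<lambda>n. \<sigma> n * (C / \<rho>)) \<longlonglongrightarrow> 0"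
          by (rule tendsto_mult_left_zero [OF \<sigma>_lim])
        have "cmod (u n x - of_real (x $ i)) \<le> \<sigma> n * (C / \<rho>)" for n
        proof -
          have "u n x - of_real (x $ i) = (k2 (y n) x - of_real (a 0)) / of_real (t n)"
            using t [of n] True zero
            by (simp add: u_def on_def \<kappa>_def linear_kernel_def k2_zero y_def e field_simps)
          moreover have "cmod (k2 (y n) x - of_real (a 0)) \<le> (\<sigma> n)\<^sup>2 * C"
            by (rule C(2)) (use \<sigma> [of n] y True in \<open>auto simp: y_def t_def e\<close>)
          then have "cmod (k2 (y n) x - of_real (a 0)) / t n \<le> (\<sigma> n)\<^sup>2 * C / t n"
            using t [of n] by (intro divide_right_mono) auto
          moreover have "(\<sigma> n)\<^sup>2 * C / t n = \<sigma> n * (C / \<rho>)"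
            using \<sigma> [of n] \<rho> by (simp add: t_def power2_eq_square field_simps)
          ultimately show ?thesis
            using t [of n] by (simp add: norm_divide)
        qed
        then show "\<forall>\<^sub>F n in sequentially. cmod (u n x - of_real (x $ i)) \<le> \<sigma> n * (C / \<rho>)"
          by simp
      qed
      then have "(\<lambda>n. u n x) \<longlonglongrightarrow> of_real (x $ i)"
        by (simp add: LIM_zero_iff)
      then show ?thesis
        using LIMSEQ_unique [OF rkhs_tendsto_eval [OF H uH w(1) True w(2)]] True
        by (simp add: coord_def on_def)
    qed
  qed
  with w show cH: "coord R i \<in> H" by simp
  fix f f'
  assume f: "f \<in> H" "(f has_derivative f') (at 0)"
  have "(\<lambda>n. (f (y n) - f 0) / of_real (t n)) \<longlonglongrightarrow> f' e"
    using has_derivative_tendsto_quotient [OF f(2) t_lim less_imp_neq [OF t, symmetric], of e]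
    by (simp add: y_def)
  moreover have "(\<lambda>n. (f (y n) - f 0) / of_real (t n)) \<longlonglongrightarrow> ip f (coord R i)"
    using tendsto_ip_right [OF uH w(1) f(1) w(2)] \<open>w = coord R i\<close> by (simp add: ip_u [OF f(1)])
  ultimately show "ip f (coord R i) = f' (axis i 1)"
    unfolding e_def by (rule LIMSEQ_unique [rotated])
qed

section \<open>Interpolation and orthogonal projection\<close>

lemma on_linear_kernel:
  "on D (linear_kernel x) = (\<Sum>i\<in>UNIV. scale_fun (of_real (x $ i)) (coord D i))"
  by (auto simp: fun_eq_iff sum_fun_apply on_def coord_def linear_kernel_def inner_vec_def)

lemma linear_part_eq:
  "linear_part D g = (\<Sum>i\<in>UNIV. scale_fun (gradient g 0 $ i) (coord D i))"
  by (auto simp: fun_eq_iff sum_fun_apply on_def coord_def linear_part_def)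

section \<open>Interpolation at the nodes\<close>

lemma matrix_inv_inverse:
  "invertible A \<Longrightarrow> A ** matrix_inv A = mat 1 \<and> matrix_inv A ** A = mat 1"
  unfolding invertible_def matrix_inv_def by (rule someI_ex)

text \<open>Invertibility makes the solution of the Gram system unique, so the definite description
  is the inverse applied to the nodal values. This form shows the linearity in
  \<open>g\<close>.\<close>

lemma interpolation_eq:
  assumes "invertible (gram k q)"
  shows "interpolation D k q g = (\<Sum>j\<in>UNIV.
    scale_fun ((matrix_inv (gram k q) *v (\<chi> i. g (q i))) $ j) (on D (\<lambda>x. k x (q j))))"
proof -
  note matrix_inv_inverse [OF assms]
  then have "(THE \<alpha>. gram k q *v \<alpha> = b) = matrix_inv (gram k q) *v b" for b
    by (intro the_equality) (auto simp: matrix_vector_mul_assoc)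
  then show ?thesis
    by (auto simp: fun_eq_iff sum_fun_apply on_def interpolation_def)
qed

lemma interpolation_apply:
  assumes "invertible (gram k q)" and "q i \<in> D"
  shows "interpolation D k q g (q i) = g (q i)"
proof -
  note matrix_inv_inverse [OF assms(1)]
  then have "(gram k q *v (matrix_inv (gram k q) *v (\<chi> i. g (q i)))) $ i = g (q i)"
    by (simp add: matrix_vector_mul_assoc)
  moreover have "(gram k q *v \<alpha>) $ i = (\<Sum>j\<in>UNIV. \<alpha> $ j * k (q i) (q j))" for \<alpha>
    by (simp add: matrix_vector_mult_def gram_def mult.commute)
  ultimately show ?thesis
    using assms by (simp add: interpolation_eq sum_fun_apply on_def)
qed

lemma interpolation_cong:
  "(\<And>i. g (q i) = h (q i)) \<Longrightarrow> interpolation D k q g = interpolation D k q h"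
  by (simp add: interpolation_def)

lemma interpolation_add:
  assumes "invertible (gram k q)"
  shows "interpolation D k q (g + h) = interpolation D k q g + interpolation D k q h"
proof -
  have "(\<chi> i. (g + h) (q i)) = (\<chi> i. g (q i)) + (\<chi> i. h (q i))"
    by (simp add: vec_eq_iff)
  then show ?thesis
    using assms
    by (simp add: interpolation_eq matrix_vector_right_distrib cfun.scale_left_distrib sum.distrib)
qed

lemma interpolation_scale:
  assumes "invertible (gram k q)"
  shows "interpolation D k q (scale_fun c g) = scale_fun c (interpolation D k q g)"
proof -
  have "(\<chi> i. scale_fun c g (q i)) = c *s (\<chi> i. g (q i))"
    by (simp add: vec_eq_iff)
  then show ?thesis
    using assms
    by (simp add: interpolation_eq vector_scalar_commute cfun.scale_sum_right)
qed

lemma interpolation_in_kernel_span: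
  "invertible (gram k q) \<Longrightarrow> interpolation D k q g \<in> kernel_span D k q"
  unfolding interpolation_eq kernel_span_def
  by (rule cfun.span_sum, rule cfun.span_scale, rule cfun.span_base, rule rangeI)

text \<open>Membership in \<open>C1 D\<close> provides a derivative within \<open>D\<close> only; at
  an interior point it is a full derivative, so \<open>gradient\<close> at 0 is meaningful.\<close>

lemma C1_has_derivative:
  assumes "f \<in> C1 D" and "0 \<in> interior D"
  shows "(f has_derivative frechet_derivative f (at 0)) (at 0)"
proof -
  have "0 \<in> D" using assms(2) interior_subset by blast
  then obtain f' where "(f has_derivative f') (at 0 within D)"
    using assms(1) by (auto simp: C1_def)
  then have "f differentiable at 0"
    unfolding at_within_interior [OF assms(2)] differentiable_def by blast
  then show ?thesis by (simp add: frechet_derivative_works)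
qed

text \<open>Abstracts from the power series: what is kept of it is the symmetry of \<open>k2\<close>
  and the representation of the partial derivatives at 0 by the coordinate functions.\<close>

locale linear_plus_rkhs =
  fixes D :: "(real^'n::finite) set" and k2 H ip
  assumes H: "rkhs_with_kernel D (\<lambda>x y. linear_kernel x y + k2 x y) H ip"
    and interior: "0 \<in> interior D"
    and coord_mem [simp]: "coord D i \<in> H"
    and ip_coord: "f \<in> H \<Longrightarrow> (f has_derivative f') (at 0) \<Longrightarrow> ip f (coord D i) = f' (axis i 1)"
    and k2_commute: "x \<in> D \<Longrightarrow> y \<in> D \<Longrightarrow> k2 x y = k2 y x"
begin

section \<open>Orthonormal coordinates and the kernel \<open>k2\<close> inside
  \<open>H\<close>\<close>

lemma rkhs: "rkhs D H ip"
  using H by (simp add: rkhs_with_kernel_def)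

sublocale ip_space H ip
  using rkhs by (rule rkhs_ip_space)

text \<open>Interpolants use the kernel as a function of its first variable, the reproducing
  property as a function of its second.\<close>

lemma k2_swap: "x \<in> D \<Longrightarrow> on D (\<lambda>y. k2 y x) = on D (k2 x)"
  by (auto simp: on_def fun_eq_iff k2_commute)

text \<open>The derivative representation applies to the coordinate functions themselves. Since
  \<open>coord\<close> is cut off outside \<open>D\<close>, the derivative is first computed within
  the interior.\<close>

lemma ip_coord_coord: "ip (coord D i) (coord D j) = (if i = j then 1 else 0)"
proof -
  have "((\<lambda>x. complex_of_real (x $ i)) has_derivative (\<lambda>x. of_real (x $ i))) (at 0 within interior D)"
    by (intro bounded_linear.has_derivative [OF bounded_linear_of_real]
        bounded_linear.has_derivative [OF bounded_linear_vec_nth] has_derivative_ident)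
  then have "(coord D i has_derivative (\<lambda>x. of_real (x $ i))) (at 0 within interior D)"
    using interior by (rule has_derivative_transform [rotated 2])
      (use interior_subset in \<open>auto simp: coord_def on_def\<close>)
  then have "(coord D i has_derivative (\<lambda>x. of_real (x $ i))) (at 0)"
    by (simp only: at_within_open [OF interior open_interior])
  then show ?thesis
    using ip_coord [OF coord_mem, of i _ j] by (simp add: axis_def)
qed

lemma linear_kernel_mem: "on D (linear_kernel x) \<in> H"
  by (simp add: on_linear_kernel)

lemma ip_linear_kernel:
  "f \<in> H \<Longrightarrow> ip f (on D (linear_kernel x)) = (\<Sum>i\<in>UNIV. of_real (x $ i) * ip f (coord D i))"
  by (simp add: on_linear_kernel ip_sum_right ip_scale_right)

lemma on_k2:
  "on D (k2 x) = on D (\<lambda>y. linear_kernel x y + k2 x y) - on D (linear_kernel x)"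
  by (auto simp: on_def fun_eq_iff)

lemma kernel_mem: "x \<in> D \<Longrightarrow> on D (\<lambda>y. linear_kernel x y + k2 x y) \<in> H"
  and ip_kernel: "x \<in> D \<Longrightarrow> f \<in> H \<Longrightarrow> ip f (on D (\<lambda>y. linear_kernel x y + k2 x y)) = f x"
  using H by (auto simp: rkhs_with_kernel_def reproducing_kernel_def)

lemma k2_mem: "x \<in> D \<Longrightarrow> on D (k2 x) \<in> H"
  unfolding on_k2 by (simp add: kernel_mem linear_kernel_mem)

text \<open>\<open>k2\<close> is the full kernel minus the linear one, and the linear kernel
  functions are combinations of coordinates, to which \<open>f\<close> is orthogonal.\<close>

lemma ip_k2:
  assumes "x \<in> D" "f \<in> H" "\<And>i. ip f (coord D i) = 0"
  shows "ip f (on D (k2 x)) = f x"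
  using assms unfolding on_k2
  by (simp add: ip_diff_right kernel_mem linear_kernel_mem ip_kernel ip_linear_kernel)

text \<open>Against a coordinate function, the full kernel and the linear kernel both return
  \<open>x $ i\<close>, the latter by orthonormality.\<close>

lemma k2_orthogonal:
  assumes "x \<in> D"
  shows "ip (on D (k2 x)) (coord D i) = 0"
proof -
  have "ip (coord D i) (on D (k2 x)) = coord D i x - of_real (x $ i)"
    using assms unfolding on_k2
    by (simp add: ip_diff_right kernel_mem linear_kernel_mem ip_kernel ip_linear_kernel
        ip_coord_coord if_distrib cong: if_cong)
  also have "\<dots> = 0" using assms by (simp add: coord_def on_def)
  finally show ?thesis
    using ip_cnj [OF coord_mem k2_mem [OF assms]] by (metis complex_cnj_zero)
qed

text \<open>By orthonormality of the coordinates, \<open>ip\<close> gives the linear kernel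
  functions their own kernel as Gram matrix, as \<open>rkhs_subset\<close> demands.\<close>

lemma linear_rkhs_subset:
  assumes "rkhs_with_kernel D linear_kernel H1 ip1"
  shows "H1 \<subseteq> H"
proof (rule rkhs_subset [OF assms rkhs linear_kernel_mem])
  fix x y assume "x \<in> D" "y \<in> D"
  have "ip (on D (linear_kernel x)) (coord D i) = of_real (x $ i)" for i
    by (simp add: on_linear_kernel ip_sum_left ip_scale_left ip_coord_coord if_distrib cong: if_cong)
  then show "ip (on D (linear_kernel x)) (on D (linear_kernel y)) = linear_kernel x y"
    by (simp add: ip_linear_kernel linear_kernel_mem linear_kernel_def inner_vec_def mult.commute)
qed

text \<open>The functions \<open>k2 x\<close> are orthogonal to the coordinates, so
  \<open>k2\<close> reproduces their values.\<close>

lemma k2_rkhs_subset: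
  assumes "rkhs_with_kernel D k2 H2 ip2"
  shows "H2 \<subseteq> H"
proof (rule rkhs_subset [OF assms rkhs k2_mem])
  fix x y assume "x \<in> D" "y \<in> D"
  then show "ip (on D (k2 x)) (on D (k2 y)) = k2 x y"
    by (simp add: ip_k2 k2_mem k2_orthogonal) (simp add: on_def)
qed

text \<open>The orthogonal projection onto the span of the coordinates. Written with inner products
  it makes sense on all of \<open>H\<close>; on members that lie in \<open>C1 D\<close> it is
  \<open>linear_part D\<close>.\<close>

definition lin :: "(real^'n \<Rightarrow> complex) \<Rightarrow> real^'n \<Rightarrow> complex" where
  "lin f = (\<Sum>i\<in>UNIV. scale_fun (ip f (coord D i)) (coord D i))"

lemma lin_mem [simp]: "lin f \<in> H"
  by (simp add: lin_def)

lemma linear_part_eq_lin: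
  assumes "f \<in> H" "f \<in> C1 D"
  shows "linear_part D f = lin f"
  using ip_coord [OF assms(1) C1_has_derivative [OF assms(2) interior]]
  by (simp add: linear_part_eq lin_def gradient_def)

lemma ip_lin_coord: "ip (lin f) (coord D i) = ip f (coord D i)"
  by (simp add: lin_def ip_sum_left ip_scale_left ip_coord_coord if_distrib cong: if_cong)

lemma ip_lin_left: "f \<in> H \<Longrightarrow> g \<in> H \<Longrightarrow> ip (lin f) g = ip f (lin g)"
  by (simp add: lin_def ip_sum_left ip_scale_left ip_sum_right ip_scale_right ip_cnj mult.commute)

lemma lin_add: "f \<in> H \<Longrightarrow> g \<in> H \<Longrightarrow> lin (f + g) = lin f + lin g"
  by (simp add: lin_def ip_add_left cfun.scale_left_distrib sum.distrib)

lemma lin_scale: "f \<in> H \<Longrightarrow> lin (scale_fun c f) = scale_fun c (lin f)"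
  by (simp add: lin_def ip_scale_left cfun.scale_sum_right)

section \<open>Self-adjointness of interpolation and of the full operator\<close>

lemma interpolation_mem:
  assumes "invertible (gram k2 q)" "range q \<subseteq> D"
  shows "interpolation D k2 q g \<in> H"
    and "ip (interpolation D k2 q g) (coord D i) = 0"
  using assms
  by (auto simp: interpolation_eq k2_swap k2_mem ip_sum_left ip_scale_left k2_orthogonal
      image_subset_iff)

lemma ip_interpolation:
  assumes inv: "invertible (gram k2 q)" and q: "range q \<subseteq> D"
    and f: "f \<in> H" "\<And>i. ip f (coord D i) = 0" and g: "g \<in> H" "\<And>i. ip g (coord D i) = 0"
  shows "ip (interpolation D k2 q f) g = ip f (interpolation D k2 q g)"
proof -
  let ?I = "interpolation D k2 q"
  have q: "q i \<in> D" for i using q by auto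
  have I: "?I h \<in> H" "ip (?I h) (coord D i) = 0" for h i
    using interpolation_mem [OF inv assms(2)] by auto
  \<comment> \<open>On the complement of the coordinates, the product with an interpolant depends on
    the nodal values only, so a function may be replaced by its own interpolant.\<close>
  have nodes: "ip h (?I h') = ip h'' (?I h')"
    if "h \<in> H" "\<And>i. ip h (coord D i) = 0" "h'' \<in> H" "\<And>i. ip h'' (coord D i) = 0"
      "\<And>i. h (q i) = h'' (q i)" for h h' h''
    using that q by (simp add: interpolation_eq [OF inv] k2_swap k2_mem ip_sum_right ip_scale_right ip_k2)
  have "ip (?I f) g = cnj (ip g (?I f))" using I g by (simp add: ip_cnj)
  also have "ip g (?I f) = ip (?I g) (?I f)"
    by (rule nodes) (use I g interpolation_apply [OF inv q] in auto)
  also have "cnj \<dots> = ip (?I f) (?I g)" using I by (simp add: ip_cnj)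
  also have "\<dots> = ip f (?I g)"
    by (rule nodes) (use I f interpolation_apply [OF inv q] in auto)
  finally show ?thesis .
qed

text \<open>On \<open>V\<close> the operator is \<open>lin\<close> plus interpolation of the
  residual \<open>f - lin f\<close>. The two summands have mutually orthogonal ranges, so
  idempotence and symmetry reduce to the pieces. Invariance of \<open>V\<close> allows this formula
  to be applied twice.\<close>

lemma orthogonal_projection_proj_op:
  assumes inv: "invertible (gram k2 q)" and q: "range q \<subseteq> D"
    and V: "cfun.subspace V" "V \<subseteq> H" "V \<subseteq> C1 D" and P: "\<And>f. f \<in> V \<Longrightarrow> proj_op D k2 q f \<in> V"
  shows "orthogonal_projection_in V ip (proj_op D k2 q)"
proof -
  let ?I = "interpolation D k2 q"
  have VH: "f \<in> V \<Longrightarrow> f \<in> H" for f using V(2) by blast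
  have eq: "proj_op D k2 q f = lin f + ?I (f - lin f)" if "f \<in> V" for f
    using that V by (auto simp: proj_op_def linear_part_eq_lin subset_iff)
  have rest: "f - lin f \<in> H" "ip (f - lin f) (coord D i) = 0" if "f \<in> V" for f i
    using VH [OF that] by (auto simp: ip_diff_left ip_lin_coord)
  note I = interpolation_mem [OF inv q]
  have ortho: "ip h (lin g) = 0" "ip (lin g) h = 0" if "h \<in> H" "\<And>i. ip h (coord D i) = 0" for g h
  proof -
    show *: "ip h (lin g) = 0" using that by (simp add: lin_def ip_sum_right ip_scale_right)
    show "ip (lin g) h = 0" using ip_cnj [OF that(1) lin_mem [of g]] * by simp
  qed
  show ?thesis
    unfolding orthogonal_projection_in_def
  proof (intro conjI ballI allI)
    fix f assume f: "f \<in> V"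
    then show "proj_op D k2 q f \<in> V" by (rule P)
    show "proj_op D k2 q (scale_fun c f) = scale_fun c (proj_op D k2 q f)" for c
      using f V(1) VH
      by (simp add: eq cfun.subspace_scale lin_scale cfun.scale_right_diff_distrib [symmetric]
          interpolation_scale [OF inv] cfun.scale_right_distrib)
    \<comment> \<open>The interpolant is orthogonal to the coordinates, so \<open>lin\<close> does
      not see it; the residual of the image is the interpolant itself.\<close>
    have lin_P: "lin (proj_op D k2 q f) = lin f"
      unfolding eq [OF f] by (simp add: lin_def ip_add_left I ip_lin_coord [unfolded lin_def])
    have "proj_op D k2 q (proj_op D k2 q f) = lin f + ?I (?I (f - lin f))"
      unfolding eq [OF P [OF f]] lin_P by (simp add: eq [OF f])
    also have "?I (?I (f - lin f)) = ?I (f - lin f)"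
      using q by (intro interpolation_cong interpolation_apply [OF inv]) auto
    also have "lin f + \<dots> = proj_op D k2 q f"
      by (simp only: eq [OF f])
    finally show "proj_op D k2 q (proj_op D k2 q f) = proj_op D k2 q f" .
    fix g assume g: "g \<in> V"
    show "proj_op D k2 q (f + g) = proj_op D k2 q f + proj_op D k2 q g"
      using f g V(1) VH interpolation_add [OF inv, of D "f - lin f" "g - lin g"]
      by (simp add: eq cfun.subspace_add lin_add algebra_simps)
    \<comment> \<open>Mixed products of \<open>lin\<close> with interpolants or residuals vanish, so
      \<open>g\<close> may be replaced by its residual in the second product.\<close>
    have "ip (proj_op D k2 q f) g = ip (lin f) g + ip (?I (f - lin f)) (g - lin g)"
      using VH [OF f] VH [OF g] I by (simp add: eq [OF f] ip_add_left ip_diff_right ortho)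
    also have "\<dots> = ip f (lin g) + ip (f - lin f) (?I (g - lin g))"
      using VH [OF f] VH [OF g] rest [OF f] rest [OF g]
      by (simp add: ip_lin_left ip_interpolation [OF inv q])
    also have "\<dots> = ip f (proj_op D k2 q g)"
      using VH [OF f] VH [OF g] I by (simp add: eq [OF g] ip_add_right ip_diff_left ortho)
    finally show "ip (proj_op D k2 q f) g = ip f (proj_op D k2 q g)" .
  qed
qed

end

theorem proposition4:
  fixes X R :: "(real^'n::finite) set"
    and F :: "real^'n \<Rightarrow> real^'n"
    and \<phi> :: "real \<Rightarrow> real^'n \<Rightarrow> real^'n"
    and a :: "nat \<Rightarrow> real"
    and k2 :: "real^'n \<Rightarrow> real^'n \<Rightarrow> complex"
    and H1 H2 H :: "(real^'n \<Rightarrow> complex) set"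
    and ip1 ip2 ip :: "(real^'n) inner_prod"
    and q :: "'m::finite \<Rightarrow> real^'n"
  assumes "compact X" and "0 \<in> X"
    and "\<exists>L. L-lipschitz_on X F" and "real_analytic_on F X"
    and "flow_map X F \<phi>"
    and "hyperbolic_equilibrium F 0" and "locally_stable X F \<phi> 0"
    and "R = region_of_attraction X F \<phi>"
    and "\<exists>r>0. ball 0 r \<subseteq> R"
    and "\<And>k. k \<noteq> 1 \<Longrightarrow> a k > 0"
    and "\<And>x y. x \<in> R \<Longrightarrow> y \<in> R \<Longrightarrow>
           ((\<lambda>k. complex_of_real (a k * (x \<bullet> y) ^ k)) has_sum k2 x y) (UNIV - {1})"
    and "rkhs_with_kernel R linear_kernel H1 ip1"
    and "rkhs_with_kernel R k2 H2 ip2"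
    and "rkhs_with_kernel R (\<lambda>x y. linear_kernel x y + k2 x y) H ip"
    and "H1 \<oplus>\<^sub>f H2 \<subseteq> C1 R"
    and "inj q" and "range q \<subseteq> R"
    and "invertible (gram k2 q)"
  shows "proj_op R k2 q \<in> C1 R \<rightarrow> H1 \<oplus>\<^sub>f kernel_span R k2 q \<and>
         orthogonal_projection_in (H1 \<oplus>\<^sub>f H2) ip (proj_op R k2 q)"
proof -
  obtain r where r: "r > 0" "ball 0 r \<subseteq> R" using assms(9) by blast
  note k2 = assms(11) and H1 = assms(12) and H2 = assms(13) and H = assms(14) and inv = assms(18)
  have q: "q i \<in> R" for i using assms(17) by auto
  interpret linear_plus_rkhs R k2 H ip
  proof
    show "0 \<in> interior R" using r by (auto simp: mem_interior)
    \<comment> \<open>The series depends on the symmetric quantity \<open>x \<bullet> y\<close>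
      only.\<close>
    show "k2 x y = k2 y x" if "x \<in> R" "y \<in> R" for x y
      using has_sum_unique [OF k2 [OF that]] k2 [OF that(2,1)] by (simp add: inner_commute)
  qed (use H coord_represents_derivative [OF r k2 H] in auto)
  have sub1: "cfun.subspace H1" and sub2: "cfun.subspace H2"
    using H1 H2 by (auto simp: rkhs_with_kernel_def rkhs_def hilbert_space_def)
  have coord1: "coord R i \<in> H1" for i
  proof -
    \<comment> \<open>A point of the ball on the axis \<open>i\<close>, whose linear kernel function
      is \<open>r / 2\<close> times the coordinate function.\<close>
    define x :: "real^'n" where "x = (r / 2) *\<^sub>R axis i 1"
    have "x \<in> R" using r by (auto simp: x_def norm_axis_1)
    then have "scale_fun (of_real (2 / r)) (on R (linear_kernel x)) \<in> H1"
      using H1 sub1 by (intro cfun.subspace_scale) (auto simp: rkhs_with_kernel_def reproducing_kernel_def)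
    also have "scale_fun (of_real (2 / r)) (on R (linear_kernel x)) = coord R i"
      using r by (auto simp: fun_eq_iff on_def coord_def linear_kernel_def x_def inner_axis')
    finally show ?thesis .
  qed
  have range: "proj_op R k2 q f \<in> H1 \<oplus>\<^sub>f kernel_span R k2 q" for f
    using sub1 coord1 interpolation_in_kernel_span [OF inv]
    by (auto simp: sum_space_def proj_op_def linear_part_eq intro!: exI cfun.subspace_sum cfun.subspace_scale)
  have "kernel_span R k2 q \<subseteq> H2"
    unfolding kernel_span_def
    using H2 q by (intro cfun.span_minimal sub2)
      (auto simp: k2_swap rkhs_with_kernel_def reproducing_kernel_def)
  then have "H1 \<oplus>\<^sub>f kernel_span R k2 q \<subseteq> H1 \<oplus>\<^sub>f H2"
    by (auto simp: sum_space_def)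
  moreover have "cfun.subspace (H1 \<oplus>\<^sub>f H2)"
    using cfun.subspace_sums [OF sub1 sub2] by (simp add: sum_space_def conj_commute)
  \<comment> \<open>The projection lemma works inside \<open>H\<close>; both summands lie there by
    comparison of kernel functions.\<close>
  moreover have "H1 \<oplus>\<^sub>f H2 \<subseteq> H"
    using linear_rkhs_subset [OF H1] k2_rkhs_subset [OF H2]
    by (auto simp: sum_space_def intro!: cfun.subspace_add [OF subspace])
  ultimately have "orthogonal_projection_in (H1 \<oplus>\<^sub>f H2) ip (proj_op R k2 q)"
    using assms(15,17) range by (intro orthogonal_projection_proj_op [OF inv]) auto
  with range show ?thesis by blast
qed

end
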